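(* Let $H$ be a connected $2$-graph (i.e. a finite simple connected graph). Then $H$ is $1$-bridgeless if and only if $\mathfrak{F}(H)$ is a $1$-tight family.
   Context: All graphs are finite and simple. $\mathfrak{F}(H)$ is the family of all graphs that contain no copy of $H$ as a (not necessarily induced) subgraph. A $1$-bridge in a graph $H$ is an edge $e \in E(H)$ for which there exists a partition $V(H) = A \sqcup B$ such that $e$ is the unique edge of $H$ with $|e \cap A| \geq 1$ and $e \cap B \neq \emptyset$ (i.e. a bridge in the usual sense when $H$ is connected). A graph is $1$-bridgeless if it has no $1$-bridge. A graph $G$ is $1$-tight if $E(G) \neq \emptyset$ and, for every $U \subsetneq V(G)$ such that $U$ contains an edge of $G$, there is an edge $e \in E(G)$ with $|e \cap U| = 1$. For a family $\mathcal{F}$ of graphs, $G \in \mathcal{F}$ is edge-maximal (in $\mathcal{F}$) if there is no $G' \in \mathcal{F}$ with $V(G') = V(G)$ and $E(G) \subsetneq E(G')$. The family $\mathcal{F}$ is a $1$-tight family if every edge-maximal $G \in \mathcal{F}$ with $|V(G)| \geq 2$ is $1$-tight. *)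

theory Defs
  imports Main "HOL-Library.Ramsey" "HOL-Library.Infinite_Typeclass"
begin

record 'a graph =
  verts :: "'a set"
  edges :: "'a set set"

definition simple_graph :: "'a graph \<Rightarrow> bool" where
  "simple_graph G \<longleftrightarrow> finite (verts G) \<and> edges G \<subseteq> [verts G]\<^bsup>2\<^esup>"

definition connected_graph :: "'a graph \<Rightarrow> bool" where
  "connected_graph G \<longleftrightarrow> verts G \<noteq> {} \<and>
     (\<forall>u\<in>verts G. \<forall>v\<in>verts G. (u, v) \<in> {(x, y). {x, y} \<in> edges G}\<^sup>*)"

definition subgraph :: "'a graph \<Rightarrow> 'a graph \<Rightarrow> bool" where
  "subgraph G' G \<longleftrightarrow> simple_graph G' \<and> verts G' \<subseteq> verts G \<and> edges G' \<subseteq> edges G"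

definition isomorphic :: "'a graph \<Rightarrow> 'b graph \<Rightarrow> bool" where
  "isomorphic G H \<longleftrightarrow>
     (\<exists>f. bij_betw f (verts G) (verts H) \<and> edges H = (\<lambda>e. f ` e) ` edges G)"

definition contains_copy :: "'b graph \<Rightarrow> 'a graph \<Rightarrow> bool" where
  "contains_copy G H \<longleftrightarrow> (\<exists>H'. subgraph H' G \<and> isomorphic H H')"

(* The vertices of the members of the family are taken from a type 'b that need not be
   the vertex type of H. When 'b is infinite, every finite graph occurs in 'b graph up to
   isomorphism; over a finite 'b only graphs of bounded order would be considered. *)
definition free_graphs :: "'a graph \<Rightarrow> 'b graph set" where
  "free_graphs H = {G. simple_graph G \<and> \<not> contains_copy G H}"

definition one_bridge :: "'a graph \<Rightarrow> 'a set \<Rightarrow> bool" where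
  "one_bridge H e \<longleftrightarrow> e \<in> edges H \<and>
     (\<exists>A B. A \<union> B = verts H \<and> A \<inter> B = {} \<and>
        (\<forall>e'\<in>edges H. card (e' \<inter> A) \<ge> 1 \<and> e' \<inter> B \<noteq> {} \<longleftrightarrow> e' = e))"

definition one_bridgeless :: "'a graph \<Rightarrow> bool" where
  "one_bridgeless H \<longleftrightarrow> \<not> (\<exists>e. one_bridge H e)"

definition one_tight :: "'a graph \<Rightarrow> bool" where
  "one_tight G \<longleftrightarrow> edges G \<noteq> {} \<and>
     (\<forall>U. U \<subset> verts G \<and> (\<exists>e\<in>edges G. e \<subseteq> U) \<longrightarrow> (\<exists>e\<in>edges G. card (e \<inter> U) = 1))"

definition edge_maximal :: "'a graph set \<Rightarrow> 'a graph \<Rightarrow> bool" where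
  "edge_maximal \<F> G \<longleftrightarrow> G \<in> \<F> \<and>
     \<not> (\<exists>G'\<in>\<F>. verts G' = verts G \<and> edges G \<subset> edges G')"

definition one_tight_family :: "'a graph set \<Rightarrow> bool" where
  "one_tight_family \<F> \<longleftrightarrow>
     (\<forall>G. edge_maximal \<F> G \<and> card (verts G) \<ge> 2 \<longrightarrow> one_tight G)"

end

theory Submission
  imports Defs
begin

text \<open>
  Everything rests on the cuts \<open>(U, V - U)\<close> of a graph and the edges that cross them: a
  \<open>1\<close>-bridge is an edge that crosses some cut alone, and a graph on at least two vertices is
  \<open>1\<close>-tight once every nontrivial cut is crossed.

  Let \<open>G\<close> be edge-maximal without a copy of \<open>H\<close>, and suppose that no edge crosses the
  nontrivial cut given by \<open>U\<close>. Join a vertex in \<open>U\<close> to one outside. By maximality a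
  copy of \<open>H\<close> appears;
  it uses the new edge, which is the only one crossing the cut, so the cut pulls back to a cut of \<open>H\<close> that is
  crossed by a single edge (\<open>single_crossing_edge_gives_one_bridge\<close>). Hence, if \<open>H\<close> is
  \<open>1\<close>-bridgeless, such a \<open>U\<close> does not exist.

  Conversely, let the connected graph \<open>H\<close> on \<open>n\<close> vertices have a \<open>1\<close>-bridge \<open>ab\<close>, and let \<open>G\<close> be
  the disjoint union of two cliques on \<open>n - 1\<close> vertices. A copy of \<open>H\<close> is connected, so in \<open>G\<close> it
  would have to fit into one clique, which is too small (\<open>two_cliques_free\<close>). Any edge that can be
  added to \<open>G\<close> joins the two cliques, and then the two sides of the bridge fit into one clique
  each, with \<open>ab\<close> mapped to the new edge (\<open>bridge_embeds_in_joined_cliques\<close>). So \<open>G\<close> is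
  edge-maximal, but it is disconnected and therefore not \<open>1\<close>-tight.
\<close>

section \<open>Embeddings and crossing edges\<close>

definition embedding :: "('a \<Rightarrow> 'b) \<Rightarrow> 'a graph \<Rightarrow> 'b graph \<Rightarrow> bool" where
  "embedding f H G \<longleftrightarrow>
     inj_on f (verts H) \<and> f ` verts H \<subseteq> verts G \<and> (\<forall>e\<in>edges H. f ` e \<in> edges G)"

definition crosses :: "'a set \<Rightarrow> 'a set \<Rightarrow> bool" where
  "crosses e U \<longleftrightarrow> e \<inter> U \<noteq> {} \<and> e - U \<noteq> {}"

definition two_cliques :: "'a set \<Rightarrow> 'a set \<Rightarrow> 'a graph" where
  "two_cliques C D = \<lparr>verts = C \<union> D, edges = [C]\<^bsup>2\<^esup> \<union> [D]\<^bsup>2\<^esup>\<rparr>"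

lemma simple_graph_edgeD:
  assumes "simple_graph G" "e \<in> edges G"
  shows "e \<subseteq> verts G" "finite e" "card e = 2"
  using assms by (auto simp: simple_graph_def nsets_def)

lemma contains_copy_iff_embedding:
  assumes H: "simple_graph H"
  shows "contains_copy G H \<longleftrightarrow> (\<exists>f. embedding f H G)"
proof
  assume "contains_copy G H"
  then obtain H' f where "subgraph H' G" "bij_betw f (verts H) (verts H')"
    "edges H' = (\<lambda>e. f ` e) ` edges H"
    unfolding contains_copy_def isomorphic_def by blast
  then have "embedding f H G"
    by (auto simp: embedding_def subgraph_def bij_betw_def)
  then show "\<exists>f. embedding f H G" by blast
next
  assume "\<exists>f. embedding f H G"
  then obtain f where f: "embedding f H G" by blast
  define H' where "H' = \<lparr>verts = f ` verts H, edges = (\<lambda>e. f ` e) ` edges H\<rparr>"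
  have "card (f ` e) = 2" if "e \<in> edges H" for e
    using simple_graph_edgeD[OF H that] f
    by (metis card_image embedding_def inj_on_subset)
  then have "simple_graph H'"
    using H simple_graph_edgeD[OF H]
    by (auto simp: simple_graph_def H'_def nsets_def)
  then have "subgraph H' G"
    using f by (auto simp: subgraph_def embedding_def H'_def)
  moreover have "isomorphic H H'"
    using f unfolding isomorphic_def
    by (intro exI[of _ f]) (auto simp: embedding_def bij_betw_def H'_def)
  ultimately show "contains_copy G H"
    unfolding contains_copy_def by blast
qed

lemma card_Int_eq_1_iff_crosses:
  assumes "card e = 2"
  shows "card (e \<inter> U) = 1 \<longleftrightarrow> crosses e U"
proof -
  obtain x y where "e = {x, y}" "x \<noteq> y"
    using assms by (auto simp: card_2_iff)
  then show ?thesis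
    by (cases "x \<in> U"; cases "y \<in> U") (auto simp: crosses_def)
qed

lemma one_bridge_iff_crosses:
  assumes H: "simple_graph H"
  shows "one_bridge H e \<longleftrightarrow>
     e \<in> edges H \<and> (\<exists>A\<subseteq>verts H. \<forall>e'\<in>edges H. crosses e' A \<longleftrightarrow> e' = e)"
proof -
  have meets: "card (e' \<inter> A) \<ge> 1 \<and> e' \<inter> B \<noteq> {} \<longleftrightarrow> crosses e' A"
    if "e' \<in> edges H" "A \<union> B = verts H" "A \<inter> B = {}" for e' A B
  proof -
    have "card (e' \<inter> A) \<ge> 1 \<longleftrightarrow> e' \<inter> A \<noteq> {}"
      using simple_graph_edgeD(2)[OF H that(1)]
      by (metis One_nat_def Suc_le_eq card_gt_0_iff finite_Int)
    moreover have "e' \<inter> B = e' - A"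
      using simple_graph_edgeD(1)[OF H that(1)] that(2,3) by blast
    ultimately show ?thesis by (simp add: crosses_def)
  qed
  have "(\<exists>A B. A \<union> B = verts H \<and> A \<inter> B = {} \<and>
          (\<forall>e'\<in>edges H. card (e' \<inter> A) \<ge> 1 \<and> e' \<inter> B \<noteq> {} \<longleftrightarrow> e' = e))
      \<longleftrightarrow> (\<exists>A\<subseteq>verts H. \<forall>e'\<in>edges H. crosses e' A \<longleftrightarrow> e' = e)" (is "?L \<longleftrightarrow> ?R")
  proof
    assume ?L
    then obtain A B where AB: "A \<union> B = verts H" "A \<inter> B = {}"
      and "\<forall>e'\<in>edges H. card (e' \<inter> A) \<ge> 1 \<and> e' \<inter> B \<noteq> {} \<longleftrightarrow> e' = e"
      by (elim exE conjE)
    with meets[OF _ AB] have "\<forall>e'\<in>edges H. crosses e' A \<longleftrightarrow> e' = e" by simp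
    moreover have "A \<subseteq> verts H" using AB(1) by (rule equalityD1[THEN le_supE])
    ultimately show ?R by (intro exI[of _ A] conjI)
  next
    assume ?R
    then obtain A where A: "A \<subseteq> verts H" "\<forall>e'\<in>edges H. crosses e' A \<longleftrightarrow> e' = e"
      by (elim exE conjE)
    then have AB: "A \<union> (verts H - A) = verts H" "A \<inter> (verts H - A) = {}" by auto
    show ?L
      using meets[OF _ AB] A(2) AB
      by (intro exI[of _ A] exI[of _ "verts H - A"]) simp
  qed
  then show ?thesis by (simp add: one_bridge_def)
qed

section \<open>Bridges from maximality\<close>

text \<open>
  A cut of \<open>G'\<close> pulls back along \<open>f\<close> to a cut of \<open>H\<close>. The assumption that \<open>f\<close> does not embed \<open>H\<close>
  into \<open>G\<close> ensures that the pulled-back cut is crossed at all.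
\<close>
lemma single_crossing_edge_gives_one_bridge:
  assumes H: "simple_graph H"
    and f: "embedding f H G'" and not_f: "\<not> embedding f H G"
    and G': "verts G' = verts G" "edges G' = insert e\<^sub>0 (edges G)"
    and cut: "crosses e\<^sub>0 U" "\<forall>e\<in>edges G. \<not> crosses e U"
  shows "\<exists>e. one_bridge H e"
proof -
  obtain e where e: "e \<in> edges H" "f ` e = e\<^sub>0"
    using f not_f G' unfolding embedding_def by auto
  define A where "A = {x \<in> verts H. f x \<in> U}"
  have "crosses e' A \<longleftrightarrow> e' = e" if e': "e' \<in> edges H" for e'
  proof -
    have sub: "e' \<subseteq> verts H" "e \<subseteq> verts H"
      using simple_graph_edgeD[OF H] e' e by auto
    then have "crosses e' A \<longleftrightarrow> crosses (f ` e') U"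
      by (auto simp: crosses_def A_def)
    moreover have "f ` e' = e\<^sub>0 \<or> f ` e' \<in> edges G"
      using f G'(2) e' by (auto simp: embedding_def)
    then have "crosses (f ` e') U \<longleftrightarrow> f ` e' = e\<^sub>0"
      using cut by metis
    moreover have "f ` e' = e\<^sub>0 \<longleftrightarrow> e' = e"
      using f e(2) sub inj_on_image_eq_iff[of f "verts H" e' e] unfolding embedding_def by simp
    ultimately show ?thesis by simp
  qed
  moreover have "A \<subseteq> verts H" by (auto simp: A_def)
  ultimately have "one_bridge H e"
    unfolding one_bridge_iff_crosses[OF H] using e(1) by (intro conjI exI[of _ A] ballI)
  then show ?thesis ..
qed

lemma edge_maximal_free_cut_crossed:
  assumes H: "simple_graph H" "one_bridgeless H"
    and G: "edge_maximal (free_graphs H) G"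
    and u: "u \<in> verts G" "u \<in> U" and v: "v \<in> verts G" "v \<notin> U"
  shows "\<exists>e\<in>edges G. crosses e U"
proof (rule ccontr)
  assume "\<not> ?thesis"
  then have none: "\<forall>e\<in>edges G. \<not> crosses e U" by blast
  define G' where "G' = \<lparr>verts = verts G, edges = insert {u, v} (edges G)\<rparr>"
  have uv: "crosses {u, v} U" using u v by (auto simp: crosses_def)
  have sG: "simple_graph G" and free: "\<not> contains_copy G H"
    using G by (auto simp: edge_maximal_def free_graphs_def)
  have "u \<noteq> v" using u v by auto
  then have sG': "simple_graph G'"
    using sG u v by (auto simp: simple_graph_def G'_def nsets_def)
  have "edges G \<subset> edges G'" using none uv by (auto simp: G'_def)
  moreover have "verts G' = verts G" by (simp add: G'_def)
  ultimately have "G' \<notin> free_graphs H" using G by (auto simp: edge_maximal_def)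
  then have "contains_copy G' H" using sG' by (simp add: free_graphs_def)
  then obtain f where "embedding f H G'"
    using contains_copy_iff_embedding[OF H(1)] by blast
  moreover have "\<not> embedding f H G"
    using free contains_copy_iff_embedding[OF H(1)] by blast
  ultimately have "\<exists>e. one_bridge H e"
    using single_crossing_edge_gives_one_bridge[OF H(1) _ _ _ _ uv none]
    by (simp add: G'_def)
  with H(2) show False by (simp add: one_bridgeless_def)
qed

lemma one_tight_if_all_cuts_crossed:
  assumes G: "simple_graph G" "card (verts G) \<ge> 2"
    and cut: "\<And>u v U. u \<in> verts G \<Longrightarrow> u \<in> U \<Longrightarrow> v \<in> verts G \<Longrightarrow> v \<notin> U \<Longrightarrow>
                 \<exists>e\<in>edges G. crosses e U"
  shows "one_tight G"
  unfolding one_tight_def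
proof (intro conjI allI impI)
  obtain u v where "u \<in> verts G" "v \<in> verts G" "u \<noteq> v"
    using G(2) by (metis card_le_Suc0_iff_eq card.infinite not_less_eq_eq numeral_2_eq_2 zero_le)
  then show "edges G \<noteq> {}"
    using cut[of u "{u}" v] by auto
next
  fix U
  assume U: "U \<subset> verts G \<and> (\<exists>e\<in>edges G. e \<subseteq> U)"
  then obtain e where e: "e \<in> edges G" "e \<subseteq> U" by blast
  then obtain u where "u \<in> e" using simple_graph_edgeD(3)[OF G(1)] by fastforce
  moreover obtain v where "v \<in> verts G" "v \<notin> U" using U by blast
  ultimately obtain e' where "e' \<in> edges G" "crosses e' U"
    using cut[of u U v] e U by blast
  then show "\<exists>e\<in>edges G. card (e \<inter> U) = 1"
    using card_Int_eq_1_iff_crosses simple_graph_edgeD(3)[OF G(1)] by blast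
qed

section \<open>The union of two cliques\<close>

text \<open>Along an edge of \<open>H\<close> the image cannot change sides, so neither can it along a path.\<close>
lemma connected_embedding_one_side:
  assumes conn: "connected_graph H"
    and f: "embedding f H G" and none: "\<forall>e\<in>edges G. \<not> crosses e U"
  shows "f ` verts H \<subseteq> U \<or> f ` verts H \<inter> U = {}"
proof -
  have "f y \<in> U \<longleftrightarrow> f x \<in> U"
    if "(x, y) \<in> {(x, y). {x, y} \<in> edges H}\<^sup>*" for x y
    using that
  proof induction
    case (step y z)
    then have "f ` {y, z} \<in> edges G" using f by (auto simp: embedding_def)
    with none have "\<not> crosses {f y, f z} U" by auto
    with step.IH show ?case by (auto simp: crosses_def)
  qed simp
  with conn show ?thesis unfolding connected_graph_def by blast
qed

lemma two_cliques_simple: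
  "finite C \<Longrightarrow> finite D \<Longrightarrow> simple_graph (two_cliques C D)"
  by (auto simp: simple_graph_def two_cliques_def nsets_def)

lemma two_cliques_uncrossed:
  assumes "C \<inter> D = {}"
  shows "\<forall>e\<in>edges (two_cliques C D). \<not> crosses e C"
  using assms by (auto simp: two_cliques_def crosses_def nsets_def)

lemma two_cliques_free:
  assumes H: "simple_graph H" "connected_graph H"
    and fin: "finite C" "finite D" and disj: "C \<inter> D = {}"
    and small: "card C < card (verts H)" "card D < card (verts H)"
  shows "two_cliques C D \<in> free_graphs H"
proof -
  have "\<not> embedding f H (two_cliques C D)" for f
  proof
    assume f: "embedding f H (two_cliques C D)"
    then have "card (f ` verts H) = card (verts H)" "f ` verts H \<subseteq> C \<union> D"
      by (auto simp: embedding_def card_image two_cliques_def)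
    moreover from connected_embedding_one_side[OF H(2) f two_cliques_uncrossed[OF disj]]
      and \<open>f ` verts H \<subseteq> C \<union> D\<close>
    have "f ` verts H \<subseteq> C \<or> f ` verts H \<subseteq> D" by blast
    ultimately show False using card_mono fin small by (metis not_le)
  qed
  then show ?thesis
    using contains_copy_iff_embedding[OF H(1)] two_cliques_simple[OF fin]
    by (auto simp: free_graphs_def)
qed

lemma inj_on_prescribed_value:
  assumes fin: "finite A" "finite C" and le: "card A \<le> card C" and "a \<in> A" "u \<in> C"
  obtains g where "inj_on g A" "g ` A \<subseteq> C" "g a = u"
proof -
  have "card (A - {a}) \<le> card (C - {u})"
    using assms by (simp add: card_Diff_singleton)
  then obtain h where h: "h ` (A - {a}) \<subseteq> C - {u}" "inj_on h (A - {a})"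
    using card_le_inj[of "A - {a}" "C - {u}"] fin by blast
  have "inj_on (h(a := u)) A"
    using h by (auto simp: inj_on_def)
  moreover have "(h(a := u)) ` A \<subseteq> C"
    using h \<open>u \<in> C\<close> by auto
  ultimately show ?thesis using that by simp
qed

lemma bridge_embeds_in_joined_cliques:
  assumes H: "simple_graph H" and bridge: "one_bridge H e"
    and fin: "finite C" "finite D" and disj: "C \<inter> D = {}"
    and large: "card C = card (verts H) - 1" "card D = card (verts H) - 1"
    and uv: "u \<in> C" "v \<in> D"
    and G: "C \<union> D \<subseteq> verts G" "insert {u, v} ([C]\<^bsup>2\<^esup> \<union> [D]\<^bsup>2\<^esup>) \<subseteq> edges G"
  shows "contains_copy G H"
proof -
  obtain A where e: "e \<in> edges H" and A: "A \<subseteq> verts H"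
    and cross: "\<forall>e'\<in>edges H. crosses e' A \<longleftrightarrow> e' = e"
    using bridge unfolding one_bridge_iff_crosses[OF H] by (elim exE conjE)
  define B where "B = verts H - A"
  have finH: "finite (verts H)" using H by (simp add: simple_graph_def)
  have "crosses e A" using cross e by blast
  then obtain a b where a: "a \<in> e" "a \<in> A" and b: "b \<in> e" "b \<notin> A"
    by (auto simp: crosses_def)
  have "b \<in> B" using b e simple_graph_edgeD(1)[OF H] by (auto simp: B_def)
  have "a \<noteq> b" using a b by auto
  have "e = {a, b}"
    using card_subset_eq[of e "{a, b}"] simple_graph_edgeD[OF H e] a b \<open>a \<noteq> b\<close> by simp
  \<comment> \<open>Each side misses an end of the bridge, so it fits into a clique on one vertex fewer.\<close>
  have AB: "finite A" "finite B" using finH A by (auto simp: B_def finite_subset)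
  have "A \<subset> verts H" "B \<subset> verts H" using a \<open>b \<in> B\<close> A by (auto simp: B_def)
  then have "card A < card (verts H)" "card B < card (verts H)"
    using finH by (simp_all add: psubset_card_mono)
  then have "card A \<le> card C" "card B \<le> card D" using large by simp_all
  then obtain g h where g: "inj_on g A" "g ` A \<subseteq> C" "g a = u"
    and h: "inj_on h B" "h ` B \<subseteq> D" "h b = v"
    using inj_on_prescribed_value AB fin a(2) \<open>b \<in> B\<close> uv by metis
  define f where "f x = (if x \<in> A then g x else h x)" for x
  have fA: "f x \<in> C" if "x \<in> A" for x using that g by (auto simp: f_def)
  have fB: "f x \<in> D" if "x \<in> B" for x using that h by (auto simp: f_def B_def)
  have inj: "inj_on f (verts H)"
  proof (rule inj_onI)
    fix x y assume xy: "x \<in> verts H" "y \<in> verts H" "f x = f y"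
    then have "x \<in> A \<longleftrightarrow> y \<in> A" using fA fB disj by (metis B_def DiffI disjoint_iff)
    then show "x = y"
      using xy g(1) h(1) by (auto simp: f_def B_def inj_on_def split: if_splits)
  qed
  have "f ` e' \<in> edges G" if e': "e' \<in> edges H" for e'
  proof (cases "e' = e")
    case True
    then have "f ` e' = {u, v}"
      using \<open>e = {a, b}\<close> a b g h by (simp add: f_def insert_commute)
    then show ?thesis using G(2) by simp
  next
    case False
    then have "\<not> crosses e' A" using cross e' by blast
    then have "e' \<subseteq> A \<or> e' \<subseteq> B"
      using simple_graph_edgeD(1)[OF H e'] by (auto simp: crosses_def B_def)
    then have "f ` e' \<subseteq> C \<or> f ` e' \<subseteq> D" using fA fB by blast
    moreover have "card (f ` e') = 2" "finite (f ` e')"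
      using simple_graph_edgeD[OF H e'] inj by (metis card_image inj_on_subset, simp)
    ultimately have "f ` e' \<in> [C]\<^bsup>2\<^esup> \<union> [D]\<^bsup>2\<^esup>" by (auto simp: nsets_def)
    then show ?thesis using G(2) by blast
  qed
  moreover have "f ` verts H \<subseteq> verts G"
    using fA fB G(1) by (auto simp: B_def)
  ultimately have "embedding f H G"
    using inj by (simp add: embedding_def)
  then show ?thesis using contains_copy_iff_embedding[OF H] by blast
qed

lemma two_cliques_edge_maximal:
  assumes H: "simple_graph H" "connected_graph H" and bridge: "one_bridge H e"
    and fin: "finite C" "finite D" and disj: "C \<inter> D = {}"
    and card: "card C = card (verts H) - 1" "card D = card (verts H) - 1"
  shows "edge_maximal (free_graphs H) (two_cliques C D)"
proof -
  have "finite (verts H)" "verts H \<noteq> {}"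
    using H by (auto simp: simple_graph_def connected_graph_def)
  then have "card (verts H) > 0" by (simp add: card_gt_0_iff)
  with card have "two_cliques C D \<in> free_graphs H"
    using two_cliques_free[OF H fin disj] by simp
  moreover have "G' \<notin> free_graphs H"
    if G': "verts G' = C \<union> D" "[C]\<^bsup>2\<^esup> \<union> [D]\<^bsup>2\<^esup> \<subset> edges G'" for G'
  proof
    assume "G' \<in> free_graphs H"
    then have sG': "simple_graph G'" and free: "\<not> contains_copy G' H"
      by (auto simp: free_graphs_def)
    obtain d where d: "d \<in> edges G'" "d \<notin> [C]\<^bsup>2\<^esup>" "d \<notin> [D]\<^bsup>2\<^esup>" using G'(2) by blast
    note dG' = simple_graph_edgeD[OF sG' d(1)]
    obtain x y where xy: "d = {x, y}" "x \<noteq> y" using dG'(3) by (auto simp: card_2_iff)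
    have "\<not> d \<subseteq> C" "\<not> d \<subseteq> D" "d \<subseteq> C \<union> D" using d dG' G'(1) by (auto simp: nsets_def)
    then have "(x \<in> C \<and> y \<in> D) \<or> (y \<in> C \<and> x \<in> D)" using xy by auto
    then obtain u v where "u \<in> C" "v \<in> D" "d = {u, v}" using xy by blast
    then have "contains_copy G' H"
      using bridge_embeds_in_joined_cliques[OF H(1) bridge fin disj card, of u v G'] G' d(1)
      by auto
    with free show False by blast
  qed
  ultimately show ?thesis
    by (auto simp: edge_maximal_def two_cliques_def)
qed

text \<open>
  For \<open>m = 1\<close> the graph has no edge, and otherwise \<open>C\<close> is a proper vertex set that contains an
  edge and is not crossed: the two clauses of \<open>1\<close>-tightness fail in turn.
\<close>
lemma two_cliques_not_one_tight:
  assumes fin: "finite C" "finite D" and disj: "C \<inter> D = {}"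
    and card: "card C = m" "card D = m" "m \<ge> 1"
  shows "\<not> one_tight (two_cliques C D)"
proof
  let ?G = "two_cliques C D"
  assume tight: "one_tight ?G"
  then obtain d where "d \<in> [C]\<^bsup>2\<^esup> \<union> [D]\<^bsup>2\<^esup>"
    by (auto simp: one_tight_def two_cliques_def)
  then have "card d = 2" "d \<subseteq> C \<or> d \<subseteq> D" by (auto simp: nsets_def)
  then have "m \<ge> 2" using card_mono[OF fin(1), of d] card_mono[OF fin(2), of d] card by auto
  then obtain e where "e \<subseteq> C" "card e = 2"
    using card(1) obtain_subset_with_card_n[of 2 C] by auto
  then have "e \<in> edges ?G" "e \<subseteq> C"
    using fin by (auto simp: two_cliques_def nsets_def finite_subset)
  moreover have "D \<noteq> {}" using card by auto
  then have "C \<subset> verts ?G" using disj by (auto simp: two_cliques_def)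
  ultimately obtain e' where e': "e' \<in> edges ?G" "card (e' \<inter> C) = 1"
    using tight unfolding one_tight_def by blast
  have "card e' = 2" using simple_graph_edgeD(3)[OF two_cliques_simple[OF fin] e'(1)] .
  then have "crosses e' C" using card_Int_eq_1_iff_crosses e'(2) by blast
  with two_cliques_uncrossed[OF disj] e'(1) show False by blast
qed

lemma ex_disjoint_sets_of_card:
  obtains C D :: "'b::infinite set"
  where "finite C" "finite D" "C \<inter> D = {}" "card C = m" "card D = m"
proof -
  obtain C :: "'b set" where C: "finite C" "card C = m"
    using infinite_arbitrarily_large[OF infinite_UNIV] by blast
  then have "infinite (UNIV - C)" using infinite_UNIV by (simp add: Diff_infinite_finite)
  then obtain D where "finite D" "card D = m" "D \<subseteq> UNIV - C"
    using infinite_arbitrarily_large by blast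
  with C that show ?thesis by blast
qed

theorem corollary1p12:
  fixes H :: "'a graph"
  assumes "simple_graph H" and "connected_graph H"
  shows "one_bridgeless H \<longleftrightarrow> one_tight_family (free_graphs H :: ('b::infinite) graph set)"
proof
  assume bridgeless: "one_bridgeless H"
  show "one_tight_family (free_graphs H :: 'b graph set)"
    unfolding one_tight_family_def
  proof (intro allI impI)
    fix G :: "'b graph"
    assume G: "edge_maximal (free_graphs H) G \<and> card (verts G) \<ge> 2"
    then have "simple_graph G" by (simp add: edge_maximal_def free_graphs_def)
    then show "one_tight G"
      using G edge_maximal_free_cut_crossed[OF assms(1) bridgeless]
      by (intro one_tight_if_all_cuts_crossed) auto
  qed
next
  assume tight: "one_tight_family (free_graphs H :: 'b graph set)"
  show "one_bridgeless H"
    unfolding one_bridgeless_def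
  proof
    assume "\<exists>e. one_bridge H e"
    then obtain e where e: "one_bridge H e" by blast
    define m where "m = card (verts H) - 1"
    have "e \<in> edges H" using e by (simp add: one_bridge_def)
    from simple_graph_edgeD[OF assms(1) this] have "card (verts H) \<ge> 2"
      using assms(1) card_mono[of "verts H" e] by (simp add: simple_graph_def)
    then have m: "m \<ge> 1" by (simp add: m_def)
    obtain C D :: "'b set" where CD: "finite C" "finite D" "C \<inter> D = {}"
      and card: "card C = m" "card D = m"
      by (rule ex_disjoint_sets_of_card)
    have "edge_maximal (free_graphs H) (two_cliques C D)"
      using two_cliques_edge_maximal[OF assms e CD] card by (simp add: m_def)
    moreover have "card (verts (two_cliques C D)) \<ge> 2"
      using CD card m by (simp add: two_cliques_def card_Un_disjoint)
    ultimately have "one_tight (two_cliques C D)"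
      using tight by (simp add: one_tight_family_def)
    then show False
      using two_cliques_not_one_tight[OF CD card m] by blast
  qed
qed

end
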